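(* Let $X$ be a finite nonempty set of cardinality $n$ and let $N=\binom{n}{2}$. The number of regular elements in $\mathcal{M}(X)$ is exactly $$\sum_{d=1}^n\binom{n}{d}\left(n^2-n+d\right)^{N}\mathrm{Surj}(n,d).$$
   Context: $\mathcal{M}(X)=X^{X\times X}$ is the set of all binary operations on $X$, a monoid under $\triangleright$ defined by $a(\circ\triangleright\ast)b=(a\circ b)\ast(b\circ a)$ for all $a,b\in X$. An element $\ast\in\mathcal{M}(X)$ is regular if there is $\circ\in\mathcal{M}(X)$ with $\ast\triangleright\circ\triangleright\ast=\ast$. $\mathrm{Surj}(m,k)$ denotes the number of surjective maps from an $m$-element set onto a $k$-element set. *)

theory Defs
  imports "HOL-Algebra.Group"
begin

definition op_triangle :: "'a set \<Rightarrow> ('a \<times> 'a \<Rightarrow> 'a) \<Rightarrow> ('a \<times> 'a \<Rightarrow> 'a) \<Rightarrow> ('a \<times> 'a \<Rightarrow> 'a)" where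
  "op_triangle X f g = (\<lambda>(a, b)\<in>X \<times> X. g (f (a, b), f (b, a)))"

text \<open>Binary operations on \<open>X\<close> are extensional functions, so that each operation on \<open>X\<close> is
  represented by exactly one HOL function and cardinalities come out right.\<close>

definition binop_monoid :: "'a set \<Rightarrow> ('a \<times> 'a \<Rightarrow> 'a) monoid" where
  "binop_monoid X =
     \<lparr>carrier = X \<times> X \<rightarrow>\<^sub>E X, mult = op_triangle X, one = (\<lambda>(a, b)\<in>X \<times> X. a)\<rparr>"

definition regular_element :: "('a, 'm) monoid_scheme \<Rightarrow> 'a \<Rightarrow> bool" where
  "regular_element M x \<longleftrightarrow>
     x \<in> carrier M \<and> (\<exists>y\<in>carrier M. x \<otimes>\<^bsub>M\<^esub> y \<otimes>\<^bsub>M\<^esub> x = x)"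

definition Surj :: "nat \<Rightarrow> nat \<Rightarrow> nat" where
  "Surj m k = card {f \<in> {..<m} \<rightarrow>\<^sub>E {..<k}. f ` {..<m} = {..<k}}"

lemma monoid_binop_monoid: "monoid (binop_monoid X)"
proof (rule monoidI)
  fix f g h
  assume f: "f \<in> carrier (binop_monoid X)" and g: "g \<in> carrier (binop_monoid X)"
  show "f \<otimes>\<^bsub>binop_monoid X\<^esub> g \<in> carrier (binop_monoid X)"
    using f g by (auto simp: binop_monoid_def op_triangle_def PiE_iff)
  show "f \<otimes>\<^bsub>binop_monoid X\<^esub> g \<otimes>\<^bsub>binop_monoid X\<^esub> h =
        f \<otimes>\<^bsub>binop_monoid X\<^esub> (g \<otimes>\<^bsub>binop_monoid X\<^esub> h)"
    using f g by (auto simp: binop_monoid_def op_triangle_def PiE_iff fun_eq_iff restrict_def)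
next
  show "\<one>\<^bsub>binop_monoid X\<^esub> \<in> carrier (binop_monoid X)"
    by (auto simp: binop_monoid_def)
next
  fix f assume f: "f \<in> carrier (binop_monoid X)"
  show "\<one>\<^bsub>binop_monoid X\<^esub> \<otimes>\<^bsub>binop_monoid X\<^esub> f = f"
    using f by (auto simp: binop_monoid_def op_triangle_def PiE_iff fun_eq_iff restrict_def extensional_def)
  show "f \<otimes>\<^bsub>binop_monoid X\<^esub> \<one>\<^bsub>binop_monoid X\<^esub> = f"
    using f by (auto simp: binop_monoid_def op_triangle_def PiE_iff fun_eq_iff restrict_def extensional_def)
qed

end

theory Submission
  imports Defs
begin

text \<open>An operation \<open>f\<close> amounts to the self-map \<open>(a, b) \<mapsto> (f (a, b), f (b, a))\<close> of
  \<open>X \<times> X\<close>, and these are exactly the maps commuting with the swap. Such a map is regular among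
  the swap-equivariant maps iff every point of its image has a preimage with the same stabilizer,
  i.e. iff every diagonal point of the image is the image of a diagonal point. To count, choose the
  restriction \<open>\<phi>\<close> to the diagonal, with image of size \<open>d\<close>; then each of the \<open>N\<close> free orbits can be
  sent to any of the \<open>n\<^sup>2 - n\<close> off-diagonal points or the \<open>d\<close> diagonal points hit by \<open>\<phi>\<close>.\<close>

section \<open>Regularity as a condition on diagonal values\<close>

lemma regular_binop_iff:
  assumes "finite X" and "X \<noteq> {}"
  shows "regular_element (binop_monoid X) f \<longleftrightarrow> f \<in> X \<times> X \<rightarrow>\<^sub>E X \<and>
    (\<forall>a\<in>X. \<forall>b\<in>X. f (a, b) = f (b, a) \<longrightarrow> (\<exists>c\<in>X. f (c, c) = f (a, b)))"
    (is "_ \<longleftrightarrow> _ \<and> ?diag")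
proof (intro iffI conjI)
  assume reg: "regular_element (binop_monoid X) f"
  then show f: "f \<in> X \<times> X \<rightarrow>\<^sub>E X"
    by (simp add: regular_element_def binop_monoid_def)
  from reg obtain g where g: "g \<in> X \<times> X \<rightarrow>\<^sub>E X"
    and eq: "op_triangle X (op_triangle X f g) f = f"
    by (auto simp: regular_element_def binop_monoid_def)
  show ?diag
  proof (intro ballI impI)
    fix a b assume ab: "a \<in> X" "b \<in> X" and sym: "f (a, b) = f (b, a)"
    \<comment> \<open>When \<open>f (a, b) = f (b, a)\<close>, the operation
      \<open>op_triangle X f g\<close> takes the same value \<open>?c\<close> at
      \<open>(a, b)\<close> and at \<open>(b, a)\<close>, so the last application of
      \<open>f\<close> happens at the diagonal point \<open>(?c, ?c)\<close>.\<close>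
    let ?c = "g (f (a, b), f (a, b))"
    have "f (?c, ?c) = op_triangle X (op_triangle X f g) f (a, b)"
      using ab sym by (simp add: op_triangle_def)
    moreover have "?c \<in> X"
      using f g ab by auto
    ultimately show "\<exists>c\<in>X. f (c, c) = f (a, b)"
      unfolding eq by blast
  qed
next
  assume "f \<in> X \<times> X \<rightarrow>\<^sub>E X \<and> ?diag"
  then have f: "f \<in> X \<times> X \<rightarrow>\<^sub>E X" and diag: ?diag
    by auto
  \<comment> \<open>A good \<open>p\<close> is a preimage of \<open>(x, y)\<close> under the
    self-map of pairs given by \<open>f\<close>, chosen on the diagonal whenever
    \<open>(x, y)\<close> lies there.\<close>
  define good where "good x y p \<longleftrightarrow> p \<in> X \<times> X \<and> f p = x \<and> f (snd p, fst p) = y \<and>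
    (x = y \<longrightarrow> fst p = snd p)" for x y p
  \<comment> \<open>Where no good preimage exists, any point of \<open>X \<times> X\<close> serves
    as a default. This keeps \<open>P\<close>, and hence \<open>g\<close>, inside \<open>X\<close>
    even off the image of \<open>f\<close>.\<close>
  have "\<exists>p\<in>X \<times> X. (\<exists>p. good x y p) \<longrightarrow> good x y p" for x y
    using \<open>X \<noteq> {}\<close> unfolding good_def by blast
  then obtain P where P: "P x y \<in> X \<times> X" "\<exists>p. good x y p \<Longrightarrow> good x y (P x y)" for x y
    by metis
  have good_ex: "\<exists>p. good (f (a, b)) (f (b, a)) p" if ab: "a \<in> X" "b \<in> X" for a b
  proof (cases "f (a, b) = f (b, a)")
    case True
    then obtain c where "c \<in> X" "f (c, c) = f (a, b)"
      using diag ab by blast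
    then have "good (f (a, b)) (f (b, a)) (c, c)"
      using True by (simp add: good_def)
    then show ?thesis ..
  next
    case False
    then have "good (f (a, b)) (f (b, a)) (a, b)"
      using ab by (simp add: good_def)
    then show ?thesis ..
  qed
  obtain r :: "'a \<Rightarrow> nat" where r: "inj_on r X"
    using finite_imp_inj_to_nat_seg[OF \<open>finite X\<close>] by blast
  \<comment> \<open>The order given by \<open>r\<close> picks one point of each swap orbit, which makes \<open>g\<close> equivariant.\<close>
  define g where
    "g = (\<lambda>(x, y)\<in>X \<times> X. if r x < r y then fst (P x y) else snd (P y x))"
  have g_in: "g \<in> X \<times> X \<rightarrow>\<^sub>E X"
    using P(1) by (auto simp: g_def mem_Times_iff)
  have g_section: "f (g (f (a, b), f (b, a)), g (f (b, a), f (a, b))) = f (a, b)"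
    if ab: "a \<in> X" "b \<in> X" for a b
  proof -
    let ?x = "f (a, b)" and ?y = "f (b, a)"
    have xy: "?x \<in> X" "?y \<in> X"
      using f ab by auto
    have 1: "good ?x ?y (P ?x ?y)" and 2: "good ?y ?x (P ?y ?x)"
      using P(2) good_ex ab by auto
    \<comment> \<open>In the first two cases the pair of \<open>g\<close>-values is
      \<open>P ?x ?y\<close> or the swap of \<open>P ?y ?x\<close>. On the diagonal \<open>g\<close>
      always takes the second component, and goodness makes both components equal.\<close>
    consider "r ?x < r ?y" | "r ?y < r ?x" | "?x = ?y"
      using r xy by (metis inj_onD nat_neq_iff)
    then show ?thesis
      using 1 2 xy by cases (auto simp: g_def good_def)
  qed
  have "op_triangle X (op_triangle X f g) f = f"
  proof
    fix p
    show "op_triangle X (op_triangle X f g) f p = f p"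
    proof (cases "p \<in> X \<times> X")
      case True
      then show ?thesis
        using g_section by (auto simp: op_triangle_def)
    next
      case False
      then show ?thesis
        using PiE_arb[OF f False] by (simp add: op_triangle_def)
    qed
  qed
  then show "regular_element (binop_monoid X) f"
    using f g_in by (auto simp: regular_element_def binop_monoid_def)
qed

section \<open>Counting surjections and pairs\<close>

text \<open>Conjugation by enumerations of \<open>A\<close> and \<open>B\<close> carries surjections
  to surjections between initial segments, and conjugation by the inverse enumerations undoes
  it.\<close>

lemma card_surjections_eq_Surj:
  assumes "finite A" and "finite B"
  shows "card {h \<in> A \<rightarrow>\<^sub>E B. h ` A = B} = Surj (card A) (card B)"
proof -
  obtain p where p: "bij_betw p A {..<card A}"
    using ex_bij_betw_finite_nat[OF \<open>finite A\<close>] by (auto simp: atLeast0LessThan)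
  obtain q where q: "bij_betw q B {..<card B}"
    using ex_bij_betw_finite_nat[OF \<open>finite B\<close>] by (auto simp: atLeast0LessThan)
  define p' where "p' = inv_into A p"
  define q' where "q' = inv_into B q"
  have p': "bij_betw p' {..<card A} A" and q': "bij_betw q' {..<card B} B"
    using p q by (simp_all add: p'_def q'_def bij_betw_inv_into)
  have inv [simp]: "a \<in> A \<Longrightarrow> p' (p a) = a" "i < card A \<Longrightarrow> p (p' i) = i"
    "b \<in> B \<Longrightarrow> q' (q b) = b" "j < card B \<Longrightarrow> q (q' j) = j" for a i b j
    using p q by (simp_all add: p'_def q'_def bij_betw_inv_into_left bij_betw_inv_into_right)
  have img: "p ` A = {..<card A}" "p' ` {..<card A} = A" "q ` B = {..<card B}" "q' ` {..<card B} = B"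
    using p p' q q' by (simp_all add: bij_betw_def)
  then have mem [simp]: "a \<in> A \<Longrightarrow> p a < card A" "i < card A \<Longrightarrow> p' i \<in> A"
    "b \<in> B \<Longrightarrow> q b < card B" "j < card B \<Longrightarrow> q' j \<in> B" for a i b j
    by blast+
  let ?to = "\<lambda>h. \<lambda>i\<in>{..<card A}. q (h (p' i))"
  let ?from = "\<lambda>h. \<lambda>a\<in>A. q' (h (p a))"
  have "bij_betw ?to {h \<in> A \<rightarrow>\<^sub>E B. h ` A = B}
    {h \<in> {..<card A} \<rightarrow>\<^sub>E {..<card B}. h ` {..<card A} = {..<card B}}"
  proof (rule bij_betw_byWitness[where f' = ?from])
    show "\<forall>h\<in>{h \<in> A \<rightarrow>\<^sub>E B. h ` A = B}. ?from (?to h) = h"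
      by (auto simp: fun_eq_iff PiE_iff extensional_def)
    show "\<forall>h\<in>{h \<in> {..<card A} \<rightarrow>\<^sub>E {..<card B}. h ` {..<card A} = {..<card B}}. ?to (?from h) = h"
      by (auto simp: fun_eq_iff PiE_iff extensional_def)
    have "?to h ` {..<card A} = {..<card B}" if "h ` A = B" for h
    proof -
      have "?to h ` {..<card A} = q ` h ` p' ` {..<card A}"
        by (simp add: image_image)
      then show ?thesis
        by (simp add: img that)
    qed
    moreover have "?to h \<in> {..<card A} \<rightarrow>\<^sub>E {..<card B}" if "h \<in> A \<rightarrow>\<^sub>E B" for h
      using that by (auto simp: PiE_iff)
    ultimately show "?to ` {h \<in> A \<rightarrow>\<^sub>E B. h ` A = B}
      \<subseteq> {h \<in> {..<card A} \<rightarrow>\<^sub>E {..<card B}. h ` {..<card A} = {..<card B}}"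
      by blast
    have "?from h ` A = B" if "h ` {..<card A} = {..<card B}" for h
    proof -
      have "?from h ` A = q' ` h ` p ` A"
        by (simp add: image_image)
      then show ?thesis
        by (simp add: img that)
    qed
    moreover have "?from h \<in> A \<rightarrow>\<^sub>E B" if "h \<in> {..<card A} \<rightarrow>\<^sub>E {..<card B}" for h
      using that by (auto simp: PiE_iff)
    ultimately show "?from ` {h \<in> {..<card A} \<rightarrow>\<^sub>E {..<card B}. h ` {..<card A} = {..<card B}}
      \<subseteq> {h \<in> A \<rightarrow>\<^sub>E B. h ` A = B}"
      by blast
  qed
  then show ?thesis
    by (simp add: Surj_def bij_betw_same_card)
qed

text \<open>Every two-element subset can be listed in exactly one way with \<open>r\<close>
  increasing. This counts the free swap orbits.\<close>

lemma card_increasing_pairs: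
  fixes r :: "'a \<Rightarrow> 'b :: linorder"
  assumes "finite X" and "inj_on r X"
  shows "card {(a, b) \<in> X \<times> X. r a < r b} = card X choose 2"
proof -
  have "bij_betw (\<lambda>(a, b). {a, b}) {(a, b) \<in> X \<times> X. r a < r b} {S. S \<subseteq> X \<and> card S = 2}"
    unfolding bij_betw_def
  proof
    show "inj_on (\<lambda>(a, b). {a, b}) {(a, b) \<in> X \<times> X. r a < r b}"
      by (auto simp: inj_on_def doubleton_eq_iff)
    show "(\<lambda>(a, b). {a, b}) ` {(a, b) \<in> X \<times> X. r a < r b} = {S. S \<subseteq> X \<and> card S = 2}"
    proof (intro equalityI subsetI)
      fix S assume "S \<in> {S. S \<subseteq> X \<and> card S = 2}"
      then obtain a b where S: "S = {a, b}" "a \<noteq> b" "a \<in> X" "b \<in> X"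
        by (auto simp: card_2_iff)
      then have "r a < r b \<or> r b < r a"
        using assms(2) by (meson inj_onD linorder_less_linear)
      then have "(a, b) \<in> {(a, b) \<in> X \<times> X. r a < r b} \<or> (b, a) \<in> {(a, b) \<in> X \<times> X. r a < r b}"
        using S by simp
      then show "S \<in> (\<lambda>(a, b). {a, b}) ` {(a, b) \<in> X \<times> X. r a < r b}"
        unfolding S(1) by (metis (no_types, lifting) case_prod_conv image_eqI insert_commute)
    qed (auto simp: card_2_iff)
  qed
  then show ?thesis
    by (simp add: bij_betw_same_card n_subsets[OF assms(1)])
qed

text \<open>Exactly the diagonal points over \<open>X - S\<close> are removed from the square. With
  \<open>S\<close> the image of the diagonal, the rest are the admissible values on a free
  orbit.\<close>

lemma card_pairs_diagonal_in:
  assumes "finite X" and "S \<subseteq> X"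
  shows "card {(x, y) \<in> X \<times> X. x = y \<longrightarrow> x \<in> S} = (card X)\<^sup>2 - card X + card S"
proof -
  have "{(x, y) \<in> X \<times> X. x = y \<longrightarrow> x \<in> S} = X \<times> X - (\<lambda>x. (x, x)) ` (X - S)"
    by auto
  moreover have "card ((\<lambda>x. (x, x)) ` (X - S)) = card X - card S"
    using assms by (simp add: card_image inj_on_def card_Diff_subset finite_subset)
  ultimately have "card {(x, y) \<in> X \<times> X. x = y \<longrightarrow> x \<in> S} = card X * card X - (card X - card S)"
    using assms(1) by (simp add: card_Diff_subset image_subset_iff card_cartesian_product)
  \<comment> \<open>Both bounds ensure that the natural-number subtractions do not truncate.\<close>
  moreover have "card S \<le> card X"
    using assms by (simp add: card_mono)
  moreover have "card X \<le> card X * card X"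
    by simp
  ultimately show ?thesis
    unfolding power2_eq_square by linarith
qed

section \<open>Regular operations as a dependent sum over their diagonals\<close>

lemma card_regular_binops:
  assumes "finite X" and "X \<noteq> {}"
  shows "card {f. regular_element (binop_monoid X) f} =
    (\<Sum>\<phi>\<in>X \<rightarrow>\<^sub>E X. ((card X)\<^sup>2 - card X + card (\<phi> ` X)) ^ (card X choose 2))"
proof -
  obtain r :: "'a \<Rightarrow> nat" where r: "inj_on r X"
    using finite_imp_inj_to_nat_seg[OF \<open>finite X\<close>] by blast
  then have total: "r a < r b \<or> r b < r a \<or> a = b" if "a \<in> X" "b \<in> X" for a b
    using that by (meson inj_onD linorder_less_linear)
  \<comment> \<open>\<open>T\<close> holds one representative of each free swap orbit. The value at
    \<open>(b, a)\<close> is recorded as the second component of the datum at \<open>(a, b)\<close>,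
    so data on \<open>T\<close> can be chosen independently.\<close>
  define T where "T = {(a, b) \<in> X \<times> X. r a < r b}"
  have T: "finite T" "card T = card X choose 2" "\<And>a b. (a, b) \<in> T \<longleftrightarrow> a \<in> X \<and> b \<in> X \<and> r a < r b"
    using assms(1) card_increasing_pairs[OF assms(1) r]
    by (auto simp: T_def intro: finite_subset[of _ "X \<times> X"])
  define V where "V \<phi> = {(x, y) \<in> X \<times> X. x = y \<longrightarrow> x \<in> \<phi> ` X}" for \<phi> :: "'a \<Rightarrow> 'a"
  define decompose where "decompose f = ((\<lambda>a\<in>X. f (a, a)), (\<lambda>(a, b)\<in>T. (f (a, b), f (b, a))))"
    for f :: "'a \<times> 'a \<Rightarrow> 'a"
  define glue where "glue = (\<lambda>(\<phi> :: 'a \<Rightarrow> 'a, \<psi> :: 'a \<times> 'a \<Rightarrow> 'a \<times> 'a). \<lambda>(a, b)\<in>X \<times> X.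
    if r a < r b then fst (\<psi> (a, b)) else if r b < r a then snd (\<psi> (b, a)) else \<phi> a)"
  have "bij_betw decompose {f. regular_element (binop_monoid X) f}
    (SIGMA \<phi>:X \<rightarrow>\<^sub>E X. T \<rightarrow>\<^sub>E V \<phi>)"
  proof (rule bij_betw_byWitness[where f' = glue])
    show "\<forall>f\<in>{f. regular_element (binop_monoid X) f}. glue (decompose f) = f"
    proof
      fix f assume "f \<in> {f. regular_element (binop_monoid X) f}"
      then have f: "f \<in> X \<times> X \<rightarrow>\<^sub>E X"
        by (simp add: regular_binop_iff[OF assms])
      show "glue (decompose f) = f"
      proof (rule extensionalityI[of _ "X \<times> X"])
        show "glue (decompose f) \<in> extensional (X \<times> X)" "f \<in> extensional (X \<times> X)"
          using f by (auto simp: glue_def decompose_def PiE_iff)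
        fix p assume "p \<in> X \<times> X"
        then obtain a b where p: "p = (a, b)" "a \<in> X" "b \<in> X"
          by auto
        then show "glue (decompose f) p = f p"
          using total[of a b] by (auto simp: glue_def decompose_def T(3))
      qed
    qed
    show "\<forall>h\<in>SIGMA \<phi>:X \<rightarrow>\<^sub>E X. T \<rightarrow>\<^sub>E V \<phi>. decompose (glue h) = h"
    proof clarify
      fix \<phi> \<psi> assume \<phi>: "\<phi> \<in> X \<rightarrow>\<^sub>E X" and \<psi>: "\<psi> \<in> T \<rightarrow>\<^sub>E V \<phi>"
      have "(\<lambda>a\<in>X. glue (\<phi>, \<psi>) (a, a)) = \<phi>"
        using \<phi> by (auto simp: glue_def fun_eq_iff PiE_iff extensional_def)
      moreover have "(\<lambda>(a, b)\<in>T. (glue (\<phi>, \<psi>) (a, b), glue (\<phi>, \<psi>) (b, a))) = \<psi>"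
        using \<psi> by (auto simp: glue_def T(3) fun_eq_iff PiE_iff extensional_def restrict_def)
      ultimately show "decompose (glue (\<phi>, \<psi>)) = (\<phi>, \<psi>)"
        by (simp add: decompose_def)
    qed
    show "decompose ` {f. regular_element (binop_monoid X) f} \<subseteq> (SIGMA \<phi>:X \<rightarrow>\<^sub>E X. T \<rightarrow>\<^sub>E V \<phi>)"
    proof (rule image_subsetI)
      fix f assume "f \<in> {f. regular_element (binop_monoid X) f}"
      then have f: "f \<in> X \<times> X \<rightarrow>\<^sub>E X" and
        diag: "\<And>a b. a \<in> X \<Longrightarrow> b \<in> X \<Longrightarrow> f (a, b) = f (b, a) \<Longrightarrow> \<exists>c\<in>X. f (c, c) = f (a, b)"
        by (auto simp: regular_binop_iff[OF assms])
      have "(f (a, b), f (b, a)) \<in> V (\<lambda>a\<in>X. f (a, a))" if ab: "a \<in> X" "b \<in> X" for a b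
      proof -
        have "f (a, b) \<in> X" "f (b, a) \<in> X"
          using f ab by auto
        moreover have "f (a, b) \<in> (\<lambda>a\<in>X. f (a, a)) ` X" if eq: "f (a, b) = f (b, a)"
        proof -
          obtain c where "c \<in> X" "f (c, c) = f (a, b)"
            using diag[OF ab eq] by blast
          then show ?thesis
            by (intro image_eqI[of _ _ c]) simp_all
        qed
        ultimately show ?thesis
          by (simp add: V_def)
      qed
      then show "decompose f \<in> (SIGMA \<phi>:X \<rightarrow>\<^sub>E X. T \<rightarrow>\<^sub>E V \<phi>)"
        using f by (auto simp: decompose_def T(3))
    qed
    show "glue ` (SIGMA \<phi>:X \<rightarrow>\<^sub>E X. T \<rightarrow>\<^sub>E V \<phi>) \<subseteq> {f. regular_element (binop_monoid X) f}"
    proof clarify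
      fix \<phi> \<psi> assume \<phi>: "\<phi> \<in> X \<rightarrow>\<^sub>E X" and \<psi>: "\<psi> \<in> T \<rightarrow>\<^sub>E V \<phi>"
      have \<psi>_in: "\<psi> (a, b) \<in> V \<phi>" if "a \<in> X" "b \<in> X" "r a < r b" for a b
        using \<psi> that by (auto simp: T(3))
      have glue_diag: "glue (\<phi>, \<psi>) (a, a) = \<phi> a" if "a \<in> X" for a
        using that by (simp add: glue_def)
      have glue_off: "(glue (\<phi>, \<psi>) (a, b), glue (\<phi>, \<psi>) (b, a)) = \<psi> (a, b)"
        if "a \<in> X" "b \<in> X" "r a < r b" for a b
        using that by (simp add: glue_def)
      \<comment> \<open>Membership in \<open>V \<phi>\<close> is controlled on \<open>T\<close>
        only. It extends to the reversed pairs because \<open>V \<phi>\<close> is closed under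
        swapping, and to the diagonal because the value there is in the image of
        \<open>\<phi>\<close>.\<close>
      have glue_V: "(glue (\<phi>, \<psi>) (a, b), glue (\<phi>, \<psi>) (b, a)) \<in> V \<phi>"
        if ab: "a \<in> X" "b \<in> X" for a b
      proof -
        consider "r a < r b" | "r b < r a" | "a = b"
          using total[OF ab] by blast
        then show ?thesis
        proof cases
          case 1
          then show ?thesis
            using glue_off[OF ab] \<psi>_in[OF ab] by simp
        next
          case 2
          then have "(glue (\<phi>, \<psi>) (b, a), glue (\<phi>, \<psi>) (a, b)) \<in> V \<phi>"
            using glue_off[of b a] \<psi>_in[of b a] ab by simp
          then show ?thesis
            unfolding V_def mem_Collect_eq case_prod_conv mem_Times_iff fst_conv snd_conv by metis
        next
          case 3
          then show ?thesis
            using ab \<phi> by (auto simp: glue_diag V_def)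
        qed
      qed
      have "glue (\<phi>, \<psi>) \<in> X \<times> X \<rightarrow>\<^sub>E X"
      proof (rule PiE_I)
        fix p assume "p \<in> X \<times> X"
        then show "glue (\<phi>, \<psi>) p \<in> X"
          using glue_V by (auto simp: V_def)
      qed (auto simp: glue_def)
      moreover have "\<exists>c\<in>X. glue (\<phi>, \<psi>) (c, c) = glue (\<phi>, \<psi>) (a, b)"
        if "a \<in> X" "b \<in> X" "glue (\<phi>, \<psi>) (a, b) = glue (\<phi>, \<psi>) (b, a)" for a b
      proof -
        have "glue (\<phi>, \<psi>) (a, b) \<in> \<phi> ` X"
          using glue_V[OF that(1,2)] that(3) by (simp add: V_def)
        then show ?thesis
          using glue_diag by (metis imageE)
      qed
      ultimately show "regular_element (binop_monoid X) (glue (\<phi>, \<psi>))"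
        by (auto simp: regular_binop_iff[OF assms])
    qed
  qed
  then have "card {f. regular_element (binop_monoid X) f} =
      card (SIGMA \<phi>:X \<rightarrow>\<^sub>E X. T \<rightarrow>\<^sub>E V \<phi>)"
    by (rule bij_betw_same_card)
  also have "\<dots> = (\<Sum>\<phi>\<in>X \<rightarrow>\<^sub>E X. card (T \<rightarrow>\<^sub>E V \<phi>))"
  proof (rule card_SigmaI)
    have "finite (V \<phi>)" for \<phi>
      using assms(1) by (auto simp: V_def intro: finite_subset[of _ "X \<times> X"])
    then show "\<forall>\<phi>\<in>X \<rightarrow>\<^sub>E X. finite (T \<rightarrow>\<^sub>E V \<phi>)"
      using T(1) by (simp add: finite_PiE)
  qed (simp add: assms(1) finite_PiE)
  also have "\<dots> = (\<Sum>\<phi>\<in>X \<rightarrow>\<^sub>E X. ((card X)\<^sup>2 - card X + card (\<phi> ` X)) ^ (card X choose 2))"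
  proof (rule sum.cong)
    fix \<phi> assume "\<phi> \<in> X \<rightarrow>\<^sub>E X"
    then have "\<phi> ` X \<subseteq> X"
      by auto
    then show "card (T \<rightarrow>\<^sub>E V \<phi>) = ((card X)\<^sup>2 - card X + card (\<phi> ` X)) ^ (card X choose 2)"
      using card_pairs_diagonal_in[OF assms(1)] T by (simp add: card_PiE V_def)
  qed simp
  finally show ?thesis .
qed

section \<open>Grouping self-maps by image size\<close>

text \<open>The sum is fibred twice, first over the image \<open>S\<close> and then over its size
  \<open>d\<close>. There are \<open>card X choose d\<close> such sets, each the image of
  \<open>Surj (card X) d\<close> maps.\<close>

lemma sum_over_self_maps_by_image:
  fixes F :: "nat \<Rightarrow> nat"
  assumes "finite X" and "X \<noteq> {}"
  shows "(\<Sum>\<phi>\<in>X \<rightarrow>\<^sub>E X. F (card (\<phi> ` X))) =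
    (\<Sum>d=1..card X. (card X choose d) * F d * Surj (card X) d)"
proof -
  \<comment> \<open>A self-map of a nonempty set has nonempty image, so the sum over sizes starts at
    1.\<close>
  define \<S> where "\<S> = Pow X - {{}}"
  have fin: "finite \<S>" "finite (X \<rightarrow>\<^sub>E X)"
    using assms(1) by (auto simp: \<S>_def finite_PiE)
  have "(\<Sum>\<phi>\<in>X \<rightarrow>\<^sub>E X. F (card (\<phi> ` X))) =
      (\<Sum>S\<in>\<S>. \<Sum>\<phi>\<in>{\<phi> \<in> X \<rightarrow>\<^sub>E X. \<phi> ` X = S}. F (card (\<phi> ` X)))"
    using fin assms(2) by (intro sum.group[symmetric]) (auto simp: \<S>_def)
  also have "\<dots> = (\<Sum>S\<in>\<S>. F (card S) * Surj (card X) (card S))"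
  proof (rule sum.cong)
    fix S assume "S \<in> \<S>"
    then have S: "S \<subseteq> X" "finite S"
      using assms(1) by (auto simp: \<S>_def finite_subset)
    \<comment> \<open>Shrinking the codomain to the image turns the fibre over \<open>S\<close> into
      the set of surjections onto \<open>S\<close>.\<close>
    then have "{\<phi> \<in> X \<rightarrow>\<^sub>E X. \<phi> ` X = S} = {\<phi> \<in> X \<rightarrow>\<^sub>E S. \<phi> ` X = S}"
      by (auto simp: PiE_iff)
    then show "(\<Sum>\<phi>\<in>{\<phi> \<in> X \<rightarrow>\<^sub>E X. \<phi> ` X = S}. F (card (\<phi> ` X))) =
        F (card S) * Surj (card X) (card S)"
      using card_surjections_eq_Surj[OF assms(1) S(2)] by simp
  qed simp
  also have "\<dots> = (\<Sum>d=1..card X. \<Sum>S\<in>{S \<in> \<S>. card S = d}. F (card S) * Surj (card X) (card S))"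
  proof (rule sum.group[symmetric])
    show "card ` \<S> \<subseteq> {1..card X}"
      using assms(1) by (auto simp: \<S>_def card_mono card_gt_0_iff Suc_le_eq finite_subset)
  qed (simp_all add: fin)
  also have "\<dots> = (\<Sum>d=1..card X. (card X choose d) * F d * Surj (card X) d)"
  proof (rule sum.cong)
    fix d assume "d \<in> {1..card X}"
    then have "{S \<in> \<S>. card S = d} = {S. S \<subseteq> X \<and> card S = d}"
      by (auto simp: \<S>_def)
    then show "(\<Sum>S\<in>{S \<in> \<S>. card S = d}. F (card S) * Surj (card X) (card S)) =
        (card X choose d) * F d * Surj (card X) d"
      by (simp add: n_subsets[OF assms(1)])
  qed simp
  finally show ?thesis .
qed

theorem theorem25:
  fixes X :: "'a set" and n N :: nat
  assumes "finite X" and "X \<noteq> {}"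
    and "n = card X" and "N = n choose 2"
  shows "card {f. regular_element (binop_monoid X) f} =
    (\<Sum>d=1..n. (n choose d) * (n\<^sup>2 - n + d) ^ N * Surj n d)"
  using card_regular_binops[OF assms(1,2)]
    sum_over_self_maps_by_image[OF assms(1,2), of "\<lambda>d. (n\<^sup>2 - n + d) ^ N"] assms(3,4)
  by simp

end
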